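(* Let $\{\widetilde{\mathcal C}_k\}_{k\in K}=\{(\{\widetilde{\mathfrak B}_j\}_{j\in J};\tilde f_k)\}_{k\in K}$ be a collection of partial probability theories on one common (finite) partial Boolean algebra, such that $\{\tilde f_k\}_{k\in K}$ is complete with respect to $\{\widetilde{\mathfrak B}_j\}_{j\in J}$. Then there exists a collection of partial probability theories $\{\mathcal C_k\}_{k\in K}=\{(\{\mathfrak B_i\}_{i\in I};f_k)\}_{k\in K}$ on a common partial Boolean algebra $\{\mathfrak B_i\}_{i\in I}$ which is embeddable into a free Boolean algebra, such that $\{\widetilde{\mathcal C}_k\}_{k\in K}$ is an empirical quotient of $\{\mathcal C_k\}_{k\in K}$.
   Context: **Partial Boolean algebra (PBA).** A set $X$ with a non-empty family $\mathcal F=\{\mathfrak B_i\}_{i\in I}$ of Boolean algebras with $\bigcup_i\mathfrak B_i=X$, such that $(P_1)$ for all $i,j$, $\mathfrak B_i\cap\mathfrak B_j\in\mathcal F$ and the Boolean operations of $\mathfrak B_i$ and $\mathfrak B_j$ coincide on it; $(P_2)$ every Boolean subalgebra of a member of $\mathcal F$ belongs to $\mathcal F$. All PBAs are assumed finite. Operations are denoted $\cap,\cup,{}^c$, zero $\emptyset$. A Boolean algebra is regarded as a PBA (with all its subalgebras). Two elements are compatible if they belong to a common member of $\mathcal F$. **State.** A map $f:X\to[0,1]$ whose restriction to each $\mathfrak B_i$ is a normalized (finitely additive) measure. A **partial probability theory (PPT)** is a pair $(\{\mathfrak B_i\};f)$ of a PBA and a state on it. **Homomorphism** of PBAs $(X,\{\mathfrak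 B_i\})\to(X',\{\mathfrak B'_j\})$: a map $\varphi:X\to X'$ such that for each $i$ the image $\varphi(\mathfrak B_i)$ belongs to $\{\mathfrak B'_j\}$ and $\varphi|_{\mathfrak B_i}$ is a homomorphism of Boolean algebras; an isomorphism is an invertible one. An embedding is an injective homomorphism into a Boolean algebra. **Complete.** $\{f_k\}$ is complete with respect to the PBA if for every $A\in X$, $A\neq\emptyset$, there is $k$ with $f_k(A)\ne0$. **Empirical quotient.** $\{(\{\widetilde{\mathfrak B}_j\}_{j\in J};\tilde f_k)\}_{k\in K}$ is an empirical quotient of $\{(\{\mathfrak B_i\}_{i\in I};f_k)\}_{k\in K}$ if there is an equivalence relation $\sim$ on $X=\bigcup_i\mathfrak B_i$ such that: (i) on each $\mathfrak B_i$, $\sim$ coincides with the equivalence relation induced by the ideal $\mathcal I_i=\{A\in\mathfrak B_i: f_k(A)=0\ \text{for all }k\in K\}$; (ii) given $A\in\mathfrak B_i$, $B\in\mathfrak B_l$ with $\mathfrak B_i,\mathfrak B_l$ maximal (by inclusion), if $A\sim B$ then there is $C\in\mathfrak B_i\cap\mathfrak B_l$ with $A\sim C$; (iii) the quotient set $X/_\sim$ is a PBA isomorphic to the PBA $\widetilde X=\bigcup_j\widetilde{\mathfrak B}_j$, so that for compatible $A,B\in X$, $[A]\cap[B]=[A\cap B]$, and analogously for $\cup$ and ${}^c$; (iv) if $\varphi:X/_\sim\to\widetilde X$ denotes the isomorphism in (iii), then $f_k(A)=\tilde f_k(\varphi([A]))$ for all $k\in K$, $A\in X$. *)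

theory Defs
  imports Complex_Main
begin

record 'a balg =
  carrier :: "'a set"
  meet :: "'a \<Rightarrow> 'a \<Rightarrow> 'a"
  join :: "'a \<Rightarrow> 'a \<Rightarrow> 'a"
  compl :: "'a \<Rightarrow> 'a"
  zero :: "'a"
  one :: "'a"

text \<open>The axioms are those of the library locale abstract_boolean_algebra, relativised to a
  carrier. The values of the operations outside the carrier are irrelevant.\<close>

definition boolean_algebra_on :: "'a balg \<Rightarrow> bool" where
  "boolean_algebra_on B \<longleftrightarrow>
     zero B \<in> carrier B \<and> one B \<in> carrier B \<and>
     (\<forall>a\<in>carrier B. compl B a \<in> carrier B \<and>
        meet B a (one B) = a \<and> join B a (zero B) = a \<and>
        meet B a (compl B a) = zero B \<and> join B a (compl B a) = one B) \<and>
     (\<forall>a\<in>carrier B. \<forall>b\<in>carrier B.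
        meet B a b \<in> carrier B \<and> join B a b \<in> carrier B \<and>
        meet B a b = meet B b a \<and> join B a b = join B b a) \<and>
     (\<forall>a\<in>carrier B. \<forall>b\<in>carrier B. \<forall>c\<in>carrier B.
        meet B (meet B a b) c = meet B a (meet B b c) \<and>
        join B (join B a b) c = join B a (join B b c) \<and>
        meet B a (join B b c) = join B (meet B a b) (meet B a c) \<and>
        join B a (meet B b c) = meet B (join B a b) (join B a c))"

definition subalgebra :: "'a set \<Rightarrow> 'a balg \<Rightarrow> bool" where
  "subalgebra S B \<longleftrightarrow>
     S \<subseteq> carrier B \<and> zero B \<in> S \<and> one B \<in> S \<and>
     (\<forall>a\<in>S. compl B a \<in> S) \<and>
     (\<forall>a\<in>S. \<forall>b\<in>S. meet B a b \<in> S \<and> join B a b \<in> S)"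

definition ba_hom :: "'a balg \<Rightarrow> 'b balg \<Rightarrow> ('a \<Rightarrow> 'b) \<Rightarrow> bool" where
  "ba_hom B C h \<longleftrightarrow>
     h ` carrier B \<subseteq> carrier C \<and> h (zero B) = zero C \<and> h (one B) = one C \<and>
     (\<forall>a\<in>carrier B. h (compl B a) = compl C (h a)) \<and>
     (\<forall>a\<in>carrier B. \<forall>b\<in>carrier B.
        h (meet B a b) = meet C (h a) (h b) \<and> h (join B a b) = join C (h a) (h b))"

text \<open>The universal property of the free Boolean algebra on \<open>G\<close>. HOL forces the test algebras
  \<open>C\<close> to live on some fixed type; taking the type of \<open>B\<close> itself loses nothing as soon as that
  type has two elements: maps into a two-element algebra already force \<open>G\<close> to be independent, and
  uniqueness of two-valued extensions forces \<open>G\<close> to generate \<open>B\<close>.\<close>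

definition free_ba_on :: "'a balg \<Rightarrow> 'a set \<Rightarrow> bool" where
  "free_ba_on B G \<longleftrightarrow>
     boolean_algebra_on B \<and> G \<subseteq> carrier B \<and>
     (\<forall>(C :: 'a balg) h. boolean_algebra_on C \<and> h ` G \<subseteq> carrier C \<longrightarrow>
        (\<exists>H. ba_hom B C H \<and> (\<forall>g\<in>G. H g = h g) \<and>
             (\<forall>H'. ba_hom B C H' \<and> (\<forall>g\<in>G. H' g = h g) \<longrightarrow> (\<forall>a\<in>carrier B. H' a = H a))))"

definition free_ba :: "'a balg \<Rightarrow> bool" where
  "free_ba B \<longleftrightarrow> (\<exists>G. free_ba_on B G)"

definition universe :: "'a balg set \<Rightarrow> 'a set" where
  "universe F = (\<Union>B\<in>F. carrier B)"

definition ops_coincide_on :: "'a set \<Rightarrow> 'a balg \<Rightarrow> 'a balg \<Rightarrow> bool" where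
  "ops_coincide_on S B C \<longleftrightarrow>
     zero B = zero C \<and> one B = one C \<and>
     (\<forall>a\<in>S. compl B a = compl C a) \<and>
     (\<forall>a\<in>S. \<forall>b\<in>S. meet B a b = meet C a b \<and> join B a b = join C a b)"

text \<open>A partial Boolean algebra is given by its family of Boolean algebras; its underlying set
  is \<open>universe F\<close>. The algebra \<open>B\<lparr>carrier := S\<rparr>\<close> is \<open>S\<close> with the operations of \<open>B\<close>.
  Finiteness is stated separately.\<close>

definition pba :: "'a balg set \<Rightarrow> bool" where
  "pba F \<longleftrightarrow>
     F \<noteq> {} \<and>
     (\<forall>B\<in>F. boolean_algebra_on B) \<and>
     (\<forall>B\<in>F. \<forall>C\<in>F. B\<lparr>carrier := carrier B \<inter> carrier C\<rparr> \<in> F \<and>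
                    ops_coincide_on (carrier B \<inter> carrier C) B C) \<and>
     (\<forall>B\<in>F. \<forall>S. subalgebra S B \<longrightarrow> B\<lparr>carrier := S\<rparr> \<in> F)"

definition pba_of_ba :: "'a balg \<Rightarrow> 'a balg set" where
  "pba_of_ba B = {B\<lparr>carrier := S\<rparr> | S. subalgebra S B}"

definition pba_hom :: "'a balg set \<Rightarrow> 'b balg set \<Rightarrow> ('a \<Rightarrow> 'b) \<Rightarrow> bool" where
  "pba_hom F F' \<phi> \<longleftrightarrow> (\<forall>B\<in>F. \<exists>B'\<in>F'. carrier B' = \<phi> ` carrier B \<and> ba_hom B B' \<phi>)"

definition pba_iso :: "'a balg set \<Rightarrow> 'b balg set \<Rightarrow> ('a \<Rightarrow> 'b) \<Rightarrow> bool" where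
  "pba_iso F F' \<phi> \<longleftrightarrow>
     pba_hom F F' \<phi> \<and> bij_betw \<phi> (universe F) (universe F') \<and>
     pba_hom F' F (inv_into (universe F) \<phi>)"

definition embedding :: "'a balg set \<Rightarrow> 'b balg \<Rightarrow> ('a \<Rightarrow> 'b) \<Rightarrow> bool" where
  "embedding F B \<phi> \<longleftrightarrow>
     boolean_algebra_on B \<and> pba_hom F (pba_of_ba B) \<phi> \<and> inj_on \<phi> (universe F)"

definition state :: "'a balg set \<Rightarrow> ('a \<Rightarrow> real) \<Rightarrow> bool" where
  "state F f \<longleftrightarrow>
     (\<forall>a\<in>universe F. 0 \<le> f a \<and> f a \<le> 1) \<and>
     (\<forall>B\<in>F. f (one B) = 1 \<and>
        (\<forall>a\<in>carrier B. \<forall>b\<in>carrier B. meet B a b = zero B \<longrightarrow> f (join B a b) = f a + f b))"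

definition ppt :: "'a balg set \<times> ('a \<Rightarrow> real) \<Rightarrow> bool" where
  "ppt C \<longleftrightarrow> pba (fst C) \<and> state (fst C) (snd C)"

definition complete_states :: "'a balg set \<Rightarrow> 'k set \<Rightarrow> ('k \<Rightarrow> 'a \<Rightarrow> real) \<Rightarrow> bool" where
  "complete_states F K f \<longleftrightarrow>
     (\<forall>B\<in>F. \<forall>a\<in>carrier B. a \<noteq> zero B \<longrightarrow> (\<exists>k\<in>K. f k a \<noteq> 0))"

definition maximal_in :: "'a balg set \<Rightarrow> 'a balg \<Rightarrow> bool" where
  "maximal_in F B \<longleftrightarrow> B \<in> F \<and> \<not> (\<exists>C\<in>F. carrier B \<subset> carrier C)"

definition null_ideal :: "'k set \<Rightarrow> ('k \<Rightarrow> 'a \<Rightarrow> real) \<Rightarrow> 'a balg \<Rightarrow> 'a set" where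
  "null_ideal K f B = {a \<in> carrier B. \<forall>k\<in>K. f k a = 0}"

definition ba_sym_diff :: "'a balg \<Rightarrow> 'a \<Rightarrow> 'a \<Rightarrow> 'a" where
  "ba_sym_diff B a b = join B (meet B a (compl B b)) (meet B (compl B a) b)"

text \<open>\<open>Q\<close> is the partial Boolean algebra structure on the quotient set \<open>universe F // r\<close>. Its
  members are exactly the images of members of \<open>F\<close>, and that \<open>a \<mapsto> [a]\<close> is a homomorphism into it
  says \<open>[a] \<inter> [b] = [a \<inter> b]\<close> for compatible \<open>a\<close>, \<open>b\<close>, and likewise for the other operations.\<close>

definition quotient_pba :: "'a balg set \<Rightarrow> ('a \<times> 'a) set \<Rightarrow> 'a set balg set \<Rightarrow> bool" where
  "quotient_pba F r Q \<longleftrightarrow>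
     pba Q \<and> universe Q = universe F // r \<and>
     pba_hom F Q (\<lambda>a. r `` {a}) \<and>
     (\<forall>D\<in>Q. \<exists>B\<in>F. carrier D = (\<lambda>a. r `` {a}) ` carrier B)"

definition empirical_quotient ::
  "'k set \<Rightarrow> 'b balg set \<Rightarrow> ('k \<Rightarrow> 'b \<Rightarrow> real) \<Rightarrow> 'a balg set \<Rightarrow> ('k \<Rightarrow> 'a \<Rightarrow> real) \<Rightarrow> bool" where
  "empirical_quotient K F' f' F f \<longleftrightarrow>
     (\<exists>r. equiv (universe F) r \<and>
        (\<forall>B\<in>F. \<forall>a\<in>carrier B. \<forall>b\<in>carrier B.
           (a, b) \<in> r \<longleftrightarrow> ba_sym_diff B a b \<in> null_ideal K f B) \<and>
        (\<forall>B C. maximal_in F B \<and> maximal_in F C \<longrightarrow>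
           (\<forall>a\<in>carrier B. \<forall>b\<in>carrier C. (a, b) \<in> r \<longrightarrow>
              (\<exists>c\<in>carrier B \<inter> carrier C. (a, c) \<in> r))) \<and>
        (\<exists>Q \<phi>. quotient_pba F r Q \<and> pba_iso Q F' \<phi> \<and>
           (\<forall>k\<in>K. \<forall>a\<in>universe F. f k a = f' k (\<phi> (r `` {a})))))"

end

(* Take the free Boolean algebra on the elements of the given partial Boolean algebra X, realised
   as the sets of valuations v <= X. A member M of the family is covered by the subalgebra of
   events depending only on the generators in M, which maps onto M by sending each generator to
   itself. Two such subalgebras meet in the events depending only on the generators in the
   intersection of the two members, so these maps agree on overlaps and the states pull back along
   them. Elements of two maximal algebras with a common image x are both equivalent to the
   generator x, which lies in both algebras; this is condition (ii) of an empirical quotient. *)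

theory Submission
  imports Defs
begin

text \<open>The obstacle is that \<open>Ft\<close> need not embed into any Boolean algebra, so no
  single algebra can serve as the target of one homomorphism from the free algebra. Homomorphisms
  exist only cylinder by cylinder, and gluing them into one map \<open>p\<close> is the crux. Once
  \<open>p\<close> is available, the relation required of an empirical quotient is its kernel:
  transitivity across different members is immediate, and the classes are the fibres of
  \<open>p\<close>. All elements of \<open>X\<close> serve as generators, even zero and one. The
  relations of a member are imposed by \<open>p\<close> alone: the event of the generator named by
  its zero is nonempty, but \<open>p\<close> sends it to zero and every pulled-back state gives it
  value 0. Completeness makes the kernel of \<open>p\<close> exactly the common null ideal. Freeness
  is reached without atoms or normal forms. Shannon expansion splits an event along one generator
  into two events independent of it; induction on the number of generators then yields both the
  existence of homomorphisms and their uniqueness.\<close>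

section \<open>Boolean algebra laws relative to a carrier\<close>

locale carrier_boolean_algebra =
  fixes B :: "'a balg"
  assumes ba: "boolean_algebra_on B"
begin

lemma closed [simp, intro]:
  "zero B \<in> carrier B" "one B \<in> carrier B"
  "a \<in> carrier B \<Longrightarrow> compl B a \<in> carrier B"
  "a \<in> carrier B \<Longrightarrow> b \<in> carrier B \<Longrightarrow> meet B a b \<in> carrier B"
  "a \<in> carrier B \<Longrightarrow> b \<in> carrier B \<Longrightarrow> join B a b \<in> carrier B"
  using ba by (simp_all add: boolean_algebra_on_def)

lemma unit_laws [simp]:
  assumes "a \<in> carrier B"
  shows "meet B a (one B) = a" "join B a (zero B) = a"
    "meet B a (compl B a) = zero B" "join B a (compl B a) = one B"
  using ba assms by (simp_all add: boolean_algebra_on_def)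

lemma commute:
  assumes "a \<in> carrier B" "b \<in> carrier B"
  shows "meet B a b = meet B b a" "join B a b = join B b a"
proof -
  have "\<forall>a\<in>carrier B. \<forall>b\<in>carrier B.
      meet B a b \<in> carrier B \<and> join B a b \<in> carrier B \<and>
      meet B a b = meet B b a \<and> join B a b = join B b a"
    using ba unfolding boolean_algebra_on_def by (elim conjE)
  then show "meet B a b = meet B b a" "join B a b = join B b a"
    using assms by blast+
qed

lemma
  assumes "a \<in> carrier B" "b \<in> carrier B" "c \<in> carrier B"
  shows assoc: "meet B (meet B a b) c = meet B a (meet B b c)"
      "join B (join B a b) c = join B a (join B b c)"
    and distrib: "meet B a (join B b c) = join B (meet B a b) (meet B a c)"
      "join B a (meet B b c) = meet B (join B a b) (join B a c)"
proof -
  have *: "\<forall>a\<in>carrier B. \<forall>b\<in>carrier B. \<forall>c\<in>carrier B.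
      meet B (meet B a b) c = meet B a (meet B b c) \<and>
      join B (join B a b) c = join B a (join B b c) \<and>
      meet B a (join B b c) = join B (meet B a b) (meet B a c) \<and>
      join B a (meet B b c) = meet B (join B a b) (join B a c)"
    using ba unfolding boolean_algebra_on_def by (elim conjE)
  from bspec[OF bspec[OF bspec[OF * assms(1)] assms(2)] assms(3)]
  show "meet B (meet B a b) c = meet B a (meet B b c)"
    "join B (join B a b) c = join B a (join B b c)"
    "meet B a (join B b c) = join B (meet B a b) (meet B a c)"
    "join B a (meet B b c) = meet B (join B a b) (join B a c)"
    by blast+
qed

lemma distrib_right:
  assumes "a \<in> carrier B" "b \<in> carrier B" "c \<in> carrier B"
  shows "meet B (join B b c) a = join B (meet B b a) (meet B c a)"
  by (metis assms closed(5) commute(1) distrib(1))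

lemma left_commute:
  assumes "a \<in> carrier B" "b \<in> carrier B" "c \<in> carrier B"
  shows "meet B a (meet B b c) = meet B b (meet B a c)"
    "join B a (join B b c) = join B b (join B a c)"
  using assoc[OF assms] assoc[OF assms(2,1,3)] commute[OF assms(1,2)] by metis+

lemma unit_laws_left [simp]:
  assumes "a \<in> carrier B"
  shows "meet B (one B) a = a" "join B (zero B) a = a"
    "meet B (compl B a) a = zero B" "join B (compl B a) a = one B"
  using assms commute[of "one B" a] commute[of "zero B" a] commute[of "compl B a" a] by simp_all

lemma meet_idem [simp]:
  assumes a: "a \<in> carrier B"
  shows "meet B a a = a"
proof -
  have "meet B a a = join B (meet B a a) (meet B a (compl B a))"
    using a by simp
  also have "\<dots> = meet B a (join B a (compl B a))"
    using a by (subst distrib) auto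
  also have "\<dots> = a"
    using a by simp
  finally show ?thesis .
qed

lemma join_idem [simp]:
  assumes a: "a \<in> carrier B"
  shows "join B a a = a"
proof -
  have "join B a a = meet B (join B a a) (join B a (compl B a))"
    using a by simp
  also have "\<dots> = join B a (meet B a (compl B a))"
    using a by (subst distrib) auto
  also have "\<dots> = a"
    using a by simp
  finally show ?thesis .
qed

lemma meet_zero [simp]:
  assumes a: "a \<in> carrier B"
  shows "meet B a (zero B) = zero B" "meet B (zero B) a = zero B"
proof -
  have "meet B a (zero B) = meet B a (meet B a (compl B a))"
    using a by simp
  also have "\<dots> = meet B (meet B a a) (compl B a)"
    using a by (subst assoc) auto
  also have "\<dots> = zero B"
    using a by simp
  finally show "meet B a (zero B) = zero B" .
  then show "meet B (zero B) a = zero B"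
    using a commute(1)[of "zero B" a] by simp
qed

lemma absorb:
  assumes a: "a \<in> carrier B" and b: "b \<in> carrier B"
  shows "meet B a (join B a b) = a"
proof -
  have "meet B a (join B a b) = meet B (join B a (zero B)) (join B a b)"
    using a by simp
  also have "\<dots> = join B a (meet B (zero B) b)"
    using a b by (subst distrib) auto
  also have "\<dots> = a"
    using a b by simp
  finally show ?thesis .
qed

lemma compl_unique:
  assumes a: "a \<in> carrier B" and b: "b \<in> carrier B"
    and "meet B a b = zero B" "join B a b = one B"
  shows "b = compl B a"
proof -
  have "b = meet B b (join B a (compl B a))"
    using a b by simp
  also have "\<dots> = meet B b (compl B a)"
    using a b assms(3) by (subst distrib) (use a b in \<open>auto simp: commute(1)[of b a]\<close>)
  also have "\<dots> = meet B (compl B a) (join B a b)"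
    using a b by (subst distrib) (use a b assms(3) in \<open>auto simp: commute(1)[of b "compl B a"] commute(1)[of b a]\<close>)
  also have "\<dots> = compl B a"
    using a assms(4) by simp
  finally show ?thesis .
qed

lemma join_eq_zero_iff:
  assumes "a \<in> carrier B" "b \<in> carrier B"
  shows "join B a b = zero B \<longleftrightarrow> a = zero B \<and> b = zero B"
  using assms absorb[of a b] absorb[of b a] by (auto simp: commute(2)[of b a])

text \<open>When both halves of the symmetric difference vanish, \<open>a\<close> and
  \<open>b\<close> each equal their meet. This turns the ideal in condition (i) into plain equality
  of images.\<close>

lemma sym_diff_eq_zero_iff:
  assumes a: "a \<in> carrier B" and b: "b \<in> carrier B"
  shows "ba_sym_diff B a b = zero B \<longleftrightarrow> a = b"
proof
  assume "ba_sym_diff B a b = zero B"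
  then have 1: "meet B a (compl B b) = zero B" "meet B (compl B a) b = zero B"
    using a b by (auto simp: ba_sym_diff_def join_eq_zero_iff)
  have "a = meet B a (join B b (compl B b))"
    using a b by simp
  also have "\<dots> = meet B a b"
    using a b 1 by (subst distrib) auto
  also have "\<dots> = meet B (join B a (compl B a)) b"
    using a b 1 by (subst distrib_right) auto
  also have "\<dots> = b"
    using a b by simp
  finally show "a = b" .
qed (use a in \<open>simp add: ba_sym_diff_def\<close>)

text \<open>With \<open>g\<close> fixed, the selection "first component inside \<open>g\<close>,
  second outside" respects joins. Together with \<open>shannon_meet\<close> this makes the
  one-generator extension in \<open>cyl_extension\<close> a homomorphism.\<close>

lemma shannon_join:
  assumes "g \<in> carrier B" "a \<in> carrier B" "b \<in> carrier B" "c \<in> carrier B" "d \<in> carrier B"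
  shows "join B (meet B g (join B a c)) (meet B (compl B g) (join B b d)) =
    join B (join B (meet B g a) (meet B (compl B g) b)) (join B (meet B g c) (meet B (compl B g) d))"
  using assms by (simp add: distrib(1) assoc left_commute)

text \<open>Expanding the right-hand side gives four terms: the two diagonal ones simplify by
  \<open>same\<close>, and the two cross terms vanish by \<open>diff\<close> because
  \<open>g\<close> is disjoint from its complement.\<close>

lemma shannon_meet:
  assumes "g \<in> carrier B" "a \<in> carrier B" "b \<in> carrier B" "c \<in> carrier B" "d \<in> carrier B"
  shows "join B (meet B g (meet B a c)) (meet B (compl B g) (meet B b d)) =
    meet B (join B (meet B g a) (meet B (compl B g) b)) (join B (meet B g c) (meet B (compl B g) d))"
proof -
  have same: "meet B (meet B x y) (meet B x z) = meet B x (meet B y z)"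
    if "x \<in> carrier B" "y \<in> carrier B" "z \<in> carrier B" for x y z
    using that by (metis assoc(1) closed(4) left_commute(1) meet_idem)
  have diff: "meet B (meet B x y) (meet B x' z) = zero B"
    if "x \<in> carrier B" "x' \<in> carrier B" "y \<in> carrier B" "z \<in> carrier B" "meet B x x' = zero B"
    for x x' y z
  proof -
    have "meet B (meet B x y) (meet B x' z) = meet B (meet B x x') (meet B y z)"
      using that(1-4) by (simp add: assoc left_commute)
    then show ?thesis using that by simp
  qed
  show ?thesis
    using assms by (simp add: distrib(1) distrib_right same diff)
qed

lemma boolean_algebra_on_subalgebra:
  assumes "subalgebra S B"
  shows "boolean_algebra_on (B\<lparr>carrier := S\<rparr>)"
proof -
  have S: "a \<in> carrier B" if "a \<in> S" for a
    using that assms by (auto simp: subalgebra_def)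
  have "zero B \<in> S" "one B \<in> S" "\<forall>a\<in>S. compl B a \<in> S" "\<forall>a\<in>S. \<forall>b\<in>S. meet B a b \<in> S \<and> join B a b \<in> S"
    using assms unfolding subalgebra_def by blast+
  then show ?thesis
    unfolding boolean_algebra_on_def
    by (auto dest!: S intro: assoc distrib commute)
qed

text \<open>Preservation of complements follows from the rest: the image of \<open>compl A a\<close>
  meets \<open>h a\<close> in zero and joins with it to one, and complements in \<open>B\<close> are
  unique.\<close>

lemma ba_homI:
  assumes "boolean_algebra_on A"
    and mem: "\<And>a. a \<in> carrier A \<Longrightarrow> h a \<in> carrier B"
    and "h (zero A) = zero B" "h (one A) = one B"
    and meet: "\<And>a b. a \<in> carrier A \<Longrightarrow> b \<in> carrier A \<Longrightarrow> h (meet A a b) = meet B (h a) (h b)"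
    and join: "\<And>a b. a \<in> carrier A \<Longrightarrow> b \<in> carrier A \<Longrightarrow> h (join A a b) = join B (h a) (h b)"
  shows "ba_hom A B h"
proof -
  interpret A: carrier_boolean_algebra A by unfold_locales fact
  have "h (compl A a) = compl B (h a)" if a: "a \<in> carrier A" for a
    using a meet[of a "compl A a"] join[of a "compl A a"] assms
    by (intro compl_unique) auto
  then show ?thesis
    using assms by (auto simp: ba_hom_def)
qed

end

lemma ba_homD:
  assumes "ba_hom A B h"
  shows "a \<in> carrier A \<Longrightarrow> h a \<in> carrier B"
    "h (zero A) = zero B" "h (one A) = one B"
    "a \<in> carrier A \<Longrightarrow> h (compl A a) = compl B (h a)"
    "a \<in> carrier A \<Longrightarrow> b \<in> carrier A \<Longrightarrow> h (meet A a b) = meet B (h a) (h b)"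
    "a \<in> carrier A \<Longrightarrow> b \<in> carrier A \<Longrightarrow> h (join A a b) = join B (h a) (h b)"
  using assms unfolding ba_hom_def by auto

lemma subalgebra_image:
  assumes "ba_hom A B h" "subalgebra S A"
  shows "subalgebra (h ` S) B"
proof -
  have S: "S \<subseteq> carrier A"
    using assms(2) by (simp add: subalgebra_def)
  have cl: "zero A \<in> S" "one A \<in> S" "\<And>a. a \<in> S \<Longrightarrow> compl A a \<in> S"
    "\<And>a b. a \<in> S \<Longrightarrow> b \<in> S \<Longrightarrow> meet A a b \<in> S" "\<And>a b. a \<in> S \<Longrightarrow> b \<in> S \<Longrightarrow> join A a b \<in> S"
    using assms(2) unfolding subalgebra_def by blast+
  note h = ba_homD[OF assms(1)]
  have "h ` S \<subseteq> carrier B" "zero B \<in> h ` S" "one B \<in> h ` S"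
    using S h(1) h(2,3)[symmetric] cl(1,2) by auto
  moreover have "compl B (h a) \<in> h ` S" if "a \<in> S" for a
    using h(4)[symmetric, of a] that S cl(3) by auto
  moreover have "meet B (h a) (h b) \<in> h ` S" "join B (h a) (h b) \<in> h ` S" if "a \<in> S" "b \<in> S" for a b
    using h(5,6)[of a b] imageI[OF cl(4)[OF that], of h] imageI[OF cl(5)[OF that], of h] that S
    by (auto simp: subset_iff)
  ultimately show ?thesis
    unfolding subalgebra_def by blast
qed

section \<open>Free Boolean algebras on finite sets\<close>

definition set_alg :: "'a set \<Rightarrow> 'a set set balg" where
  "set_alg X = \<lparr>carrier = Pow (Pow X), meet = (\<inter>), join = (\<union>), compl = (\<lambda>A. Pow X - A),
     zero = {}, one = Pow X\<rparr>"

definition gen :: "'a set \<Rightarrow> 'a \<Rightarrow> 'a set set" where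
  "gen X x = {v. v \<subseteq> X \<and> x \<in> v}"

text \<open>Reading \<open>v \<subseteq> X\<close> as a valuation of the generators, \<open>cyl X S\<close> consists of the events that
  depend on the generators in \<open>S\<close> only.\<close>

definition cyl :: "'a set \<Rightarrow> 'a set \<Rightarrow> 'a set set set" where
  "cyl X S = {A. A \<subseteq> Pow X \<and> (\<forall>v\<subseteq>X. v \<in> A \<longleftrightarrow> v \<inter> S \<in> A)}"

lemma cylI: "A \<subseteq> Pow X \<Longrightarrow> (\<And>v. v \<subseteq> X \<Longrightarrow> v \<in> A \<longleftrightarrow> v \<inter> S \<in> A) \<Longrightarrow> A \<in> cyl X S"
  unfolding cyl_def by blast

lemma cyl_subset: "A \<in> cyl X S \<Longrightarrow> A \<subseteq> Pow X"
  unfolding cyl_def by blast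

lemma cyl_iff: "A \<in> cyl X S \<Longrightarrow> v \<subseteq> X \<Longrightarrow> v \<in> A \<longleftrightarrow> v \<inter> S \<in> A"
  unfolding cyl_def by blast

lemma set_alg_simps [simp]:
  "carrier (set_alg X) = Pow (Pow X)" "meet (set_alg X) = (\<inter>)" "join (set_alg X) = (\<union>)"
  "compl (set_alg X) = (\<lambda>A. Pow X - A)" "zero (set_alg X) = {}" "one (set_alg X) = Pow X"
  by (simp_all add: set_alg_def)

lemma boolean_algebra_on_set_alg: "boolean_algebra_on (set_alg X)"
  unfolding boolean_algebra_on_def by auto

lemma subalgebra_cyl: "subalgebra (cyl X S) (set_alg X)"
  unfolding subalgebra_def
  by (auto intro!: cylI dest: cyl_subset cyl_iff)

lemma cyl_self: "cyl X X = Pow (Pow X)"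
  by (auto simp: cyl_def Int_absorb2)

text \<open>For an event in both cylinders, first forget the generators outside \<open>S\<close>,
  then apply the second condition to the already restricted valuation \<open>v \<inter> S\<close>.
  Conversely, \<open>v\<close> and \<open>v \<inter> U\<close> have the same trace on
  \<open>S \<inter> T\<close>.\<close>

lemma cyl_Int: "cyl X S \<inter> cyl X T = cyl X (S \<inter> T)"
proof (intro equalityI subsetI)
  fix A assume A: "A \<in> cyl X S \<inter> cyl X T"
  show "A \<in> cyl X (S \<inter> T)"
  proof (rule cylI)
    show "A \<subseteq> Pow X"
      using A cyl_subset by blast
    show "v \<in> A \<longleftrightarrow> v \<inter> (S \<inter> T) \<in> A" if v: "v \<subseteq> X" for v
      using cyl_iff[of A X S v] cyl_iff[of A X T "v \<inter> S"] A v by (simp add: Int_assoc le_infI1)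
  qed
next
  fix A assume A: "A \<in> cyl X (S \<inter> T)"
  have U: "A \<in> cyl X U" if U: "U = S \<or> U = T" for U
  proof (rule cylI)
    show "A \<subseteq> Pow X"
      using A by (rule cyl_subset)
    show "v \<in> A \<longleftrightarrow> v \<inter> U \<in> A" if v: "v \<subseteq> X" for v
    proof -
      have "(v \<inter> U) \<inter> (S \<inter> T) = v \<inter> (S \<inter> T)"
        using U by blast
      moreover have "v \<inter> U \<subseteq> X"
        using v by blast
      ultimately show ?thesis
        using cyl_iff[OF A v] cyl_iff[OF A, of "v \<inter> U"] by simp
    qed
  qed
  show "A \<in> cyl X S \<inter> cyl X T"
    using U by simp
qed

lemma gen_in_cyl: "x \<in> S \<Longrightarrow> gen X x \<in> cyl X S"
  by (intro cylI) (auto simp: gen_def)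

section \<open>Shannon expansion and the universal property of cylinders\<close>

text \<open>Reading \<open>A\<close> as a Boolean function of the generators, this substitutes true
  for \<open>g\<close>; \<open>cofactor0\<close> substitutes false. Both are preimages of
  \<open>A\<close>, hence compatible with the set operations.\<close>

definition cofactor1 :: "'a set \<Rightarrow> 'a \<Rightarrow> 'a set set \<Rightarrow> 'a set set" where
  "cofactor1 X g A = {v. v \<subseteq> X \<and> insert g v \<in> A}"

definition cofactor0 :: "'a set \<Rightarrow> 'a \<Rightarrow> 'a set set \<Rightarrow> 'a set set" where
  "cofactor0 X g A = {v. v \<subseteq> X \<and> v - {g} \<in> A}"

lemma cofactors_in_cyl:
  assumes A: "A \<in> cyl X (insert g S)" and "g \<in> X" "g \<notin> S"
  shows "cofactor1 X g A \<in> cyl X S" "cofactor0 X g A \<in> cyl X S"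
proof -
  \<comment> \<open>The cylinder condition in congruence form: membership depends only on the trace
    on \<open>insert g S\<close>.\<close>
  have *: "w \<in> A \<longleftrightarrow> w' \<in> A" if "w \<subseteq> X" "w' \<subseteq> X" "w \<inter> insert g S = w' \<inter> insert g S" for w w'
    using cyl_iff[OF A, of w] cyl_iff[OF A, of w'] that by simp
  have "insert g v \<in> A \<longleftrightarrow> insert g (v \<inter> S) \<in> A" if "v \<subseteq> X" for v
    using that assms(2) by (intro *) auto
  then show "cofactor1 X g A \<in> cyl X S"
    by (intro cylI) (auto simp: cofactor1_def)
  have "v - {g} \<in> A \<longleftrightarrow> v \<inter> S - {g} \<in> A" if "v \<subseteq> X" for v
    using that by (intro *) auto
  then show "cofactor0 X g A \<in> cyl X S"
    by (intro cylI) (auto simp: cofactor0_def)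
qed

lemma shannon_expansion:
  assumes "A \<subseteq> Pow X"
  shows "A = gen X g \<inter> cofactor1 X g A \<union> (Pow X - gen X g) \<inter> cofactor0 X g A"
proof (rule set_eqI)
  fix v
  have "insert g v = v" if "g \<in> v"
    using that by blast
  moreover have "v - {g} = v" if "g \<notin> v"
    using that by blast
  ultimately show "v \<in> A \<longleftrightarrow> v \<in> gen X g \<inter> cofactor1 X g A \<union> (Pow X - gen X g) \<inter> cofactor0 X g A"
    using assms by (cases "g \<in> v") (auto simp: gen_def cofactor1_def cofactor0_def)
qed

text \<open>Every valuation restricts to \<open>{}\<close>, so whether \<open>{}\<close> lies in
  \<open>A\<close> decides everything. This is the base case for generation.\<close>

lemma cyl_empty: "A \<in> cyl X {} \<Longrightarrow> A = {} \<or> A = Pow X"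
proof -
  assume A: "A \<in> cyl X {}"
  have "v \<in> A \<longleftrightarrow> {} \<in> A" if "v \<subseteq> X" for v
    using cyl_iff[OF A that] by (simp only: Int_empty_right)
  then show ?thesis
    using cyl_subset[OF A] by (cases "{} \<in> A") blast+
qed

text \<open>By Shannon expansion an event is a Boolean combination of \<open>gen X g\<close> and two
  cofactors in the smaller cylinder. Taking for \<open>T\<close> the set where two homomorphisms
  agree, this becomes the uniqueness principle used for freeness and for gluing.\<close>

lemma cyl_generated:
  assumes "finite S" "S \<subseteq> X" "subalgebra T (set_alg X)" "gen X ` S \<subseteq> T"
  shows "cyl X S \<subseteq> T"
  using assms(1,2,4)
proof (induction S rule: finite_induct)
  case empty
  then show ?case
    using assms(3) by (auto simp: subalgebra_def dest: cyl_empty)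
next
  case (insert g S)
  show ?case
  proof
    fix A assume A: "A \<in> cyl X (insert g S)"
    then have "cofactor1 X g A \<in> T" "cofactor0 X g A \<in> T" "gen X g \<in> T"
      using insert cofactors_in_cyl[OF A] by auto
    then have "gen X g \<inter> cofactor1 X g A \<union> (Pow X - gen X g) \<inter> cofactor0 X g A \<in> T"
      using assms(3) by (simp add: subalgebra_def)
    moreover have "A \<subseteq> Pow X"
      using A by (rule cyl_subset)
    ultimately show "A \<in> T"
      using shannon_expansion by metis
  qed
qed

text \<open>The existence half of freeness, one generator at a time. The target lives on an
  arbitrary type because it is applied both to test algebras on the type of \<open>set_alg X\<close>
  and to the members of \<open>Ft\<close>.\<close>

lemma cyl_extension:
  fixes C :: "'b balg" and h :: "'a \<Rightarrow> 'b"
  assumes C: "boolean_algebra_on C" and "finite S" "S \<subseteq> X" "h ` S \<subseteq> carrier C"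
  shows "\<exists>H. ba_hom (set_alg X\<lparr>carrier := cyl X S\<rparr>) C H \<and> (\<forall>x\<in>S. H (gen X x) = h x)"
  using assms(2-4)
proof (induction S rule: finite_induct)
  case empty
  interpret carrier_boolean_algebra C by unfold_locales fact
  interpret S: carrier_boolean_algebra "set_alg X" by unfold_locales (rule boolean_algebra_on_set_alg)
  \<comment> \<open>Evaluation at the valuation \<open>{}\<close> is a two-valued
    homomorphism.\<close>
  have "ba_hom (set_alg X\<lparr>carrier := cyl X {}\<rparr>) C (\<lambda>A. if {} \<in> A then one C else zero C)"
    by (rule ba_homI) (auto simp: S.boolean_algebra_on_subalgebra subalgebra_cyl)
  then show ?case by auto
next
  case (insert g S)
  interpret carrier_boolean_algebra C by unfold_locales fact
  interpret S: carrier_boolean_algebra "set_alg X" by unfold_locales (rule boolean_algebra_on_set_alg)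
  obtain H where H: "ba_hom (set_alg X\<lparr>carrier := cyl X S\<rparr>) C H" and gen: "\<forall>x\<in>S. H (gen X x) = h x"
    using insert by auto
  note HD = ba_homD[OF H, simplified]
  have g: "h g \<in> carrier C" "g \<in> X"
    using insert.prems by auto
  note cof = cofactors_in_cyl[OF _ g(2) insert.hyps(2)]
  \<comment> \<open>This value is forced: it is what a homomorphism extending \<open>H\<close> and
    sending \<open>gen X g\<close> to \<open>h g\<close> gives on the Shannon expansion of
    \<open>A\<close>.\<close>
  define H' where "H' A =
    join C (meet C (h g) (H (cofactor1 X g A))) (meet C (compl C (h g)) (H (cofactor0 X g A)))" for A
  have cof_meet: "cofactor1 X g (A \<inter> A') = cofactor1 X g A \<inter> cofactor1 X g A'"
    "cofactor0 X g (A \<inter> A') = cofactor0 X g A \<inter> cofactor0 X g A'" for A A'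
    by (auto simp: cofactor1_def cofactor0_def)
  have cof_join: "cofactor1 X g (A \<union> A') = cofactor1 X g A \<union> cofactor1 X g A'"
    "cofactor0 X g (A \<union> A') = cofactor0 X g A \<union> cofactor0 X g A'" for A A'
    by (auto simp: cofactor1_def cofactor0_def)
  have cof_const: "cofactor1 X g {} = {}" "cofactor0 X g {} = {}"
    "cofactor1 X g (Pow X) = Pow X" "cofactor0 X g (Pow X) = Pow X"
    using g(2) by (auto simp: cofactor1_def cofactor0_def)
  have "ba_hom (set_alg X\<lparr>carrier := cyl X (insert g S)\<rparr>) C H'"
  proof (rule ba_homI)
    show "boolean_algebra_on (set_alg X\<lparr>carrier := cyl X (insert g S)\<rparr>)"
      by (simp add: S.boolean_algebra_on_subalgebra subalgebra_cyl)
  qed (use g in \<open>simp_all add: H'_def cof HD cof_meet cof_join cof_const shannon_meet shannon_join\<close>)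
  moreover have "H' (gen X g) = h g"
  proof -
    have "cofactor1 X g (gen X g) = Pow X" "cofactor0 X g (gen X g) = {}"
      using g(2) by (auto simp: cofactor1_def cofactor0_def gen_def)
    then show ?thesis using g by (simp add: H'_def HD)
  qed
  moreover have "H' (gen X x) = h x" if x: "x \<in> S" for x
  proof -
    have "cofactor1 X g (gen X x) = gen X x" "cofactor0 X g (gen X x) = gen X x"
      using g(2) x insert.hyps(2) by (auto simp: cofactor1_def cofactor0_def gen_def)
    moreover have "h x \<in> carrier C"
      using x insert.prems by auto
    ultimately show ?thesis
      using g x gen by (simp add: H'_def distrib_right[symmetric])
  qed
  ultimately show ?case by auto
qed

text \<open>For \<open>S = X\<close> the cylinder is the full algebra, so
  \<open>cyl_extension\<close> and \<open>cyl_generated\<close> give existence and uniqueness.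
  Finiteness matters: for infinite \<open>X\<close>, finite Boolean combinations of the generators
  do not exhaust \<open>Pow (Pow X)\<close>.\<close>

lemma free_ba_set_alg:
  assumes "finite X"
  shows "free_ba (set_alg X)"
proof -
  have carr: "set_alg X\<lparr>carrier := cyl X X\<rparr> = set_alg X"
    by (simp add: cyl_self set_alg_def)
  have ex: "\<exists>H. ba_hom (set_alg X) C H \<and> (\<forall>g\<in>gen X ` X. H g = h g)"
    if C: "boolean_algebra_on C" "h ` gen X ` X \<subseteq> carrier C"
    for C :: "'a set set balg" and h
    using cyl_extension[OF C(1) assms order_refl, of "\<lambda>x. h (gen X x)"] C(2) carr
    by (simp add: image_image)
  have uniq: "H' A = H A"
    if H: "ba_hom (set_alg X) C H" "\<forall>g\<in>gen X ` X. H g = h g"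
      and H': "ba_hom (set_alg X) C H'" "\<forall>g\<in>gen X ` X. H' g = h g"
      and A: "A \<in> carrier (set_alg X)"
    for C :: "'a set set balg" and h H H' A
  proof -
    \<comment> \<open>The equalizer of the two homomorphisms is a subalgebra containing the
      generators.\<close>
    let ?T = "{A \<in> Pow (Pow X). H' A = H A}"
    have "subalgebra ?T (set_alg X)"
      unfolding subalgebra_def
      using ba_homD[OF H(1), simplified] ba_homD[OF H'(1), simplified] by auto
    moreover have "gen X ` X \<subseteq> ?T"
      using H(2) H'(2) by (auto simp: gen_def)
    ultimately have "cyl X X \<subseteq> ?T"
      by (rule cyl_generated[OF assms order_refl])
    moreover have "A \<in> cyl X X"
      using A by (simp add: cyl_self)
    ultimately have "A \<in> ?T"
      by (rule subsetD)
    then show ?thesis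
      by simp
  qed
  have "free_ba_on (set_alg X) (gen X ` X)"
    unfolding free_ba_on_def
  proof (intro conjI allI impI)
    show "gen X ` X \<subseteq> carrier (set_alg X)"
      by (auto simp: gen_def)
    fix C :: "'a set set balg" and h
    assume C: "boolean_algebra_on C \<and> h ` gen X ` X \<subseteq> carrier C"
    obtain H where H: "ba_hom (set_alg X) C H" "\<forall>g\<in>gen X ` X. H g = h g"
      using ex[OF conjunct1[OF C] conjunct2[OF C]] by (elim exE conjE)
    show "\<exists>H. ba_hom (set_alg X) C H \<and> (\<forall>g\<in>gen X ` X. H g = h g) \<and>
        (\<forall>H'. ba_hom (set_alg X) C H' \<and> (\<forall>g\<in>gen X ` X. H' g = h g) \<longrightarrow>
          (\<forall>a\<in>carrier (set_alg X). H' a = H a))"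
    proof (intro exI[of _ H] conjI allI impI)
      fix H' assume H': "ba_hom (set_alg X) C H' \<and> (\<forall>g\<in>gen X ` X. H' g = h g)"
      show "\<forall>a\<in>carrier (set_alg X). H' a = H a"
        using uniq[OF H conjunct1[OF H'] conjunct2[OF H']] by (rule ballI)
    qed (fact H)+
  qed (rule boolean_algebra_on_set_alg)
  then show ?thesis
    unfolding free_ba_def by blast
qed

section \<open>Partial Boolean algebras\<close>

lemma pbaD:
  assumes "pba F"
  shows "F \<noteq> {}"
    "B \<in> F \<Longrightarrow> boolean_algebra_on B"
    "B \<in> F \<Longrightarrow> C \<in> F \<Longrightarrow> B\<lparr>carrier := carrier B \<inter> carrier C\<rparr> \<in> F"
    "B \<in> F \<Longrightarrow> C \<in> F \<Longrightarrow> ops_coincide_on (carrier B \<inter> carrier C) B C"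
    "B \<in> F \<Longrightarrow> subalgebra S B \<Longrightarrow> B\<lparr>carrier := S\<rparr> \<in> F"
proof -
  have 2: "\<forall>B\<in>F. boolean_algebra_on B"
    using assms unfolding pba_def by (elim conjE)
  have 3: "\<forall>B\<in>F. \<forall>C\<in>F. B\<lparr>carrier := carrier B \<inter> carrier C\<rparr> \<in> F \<and>
      ops_coincide_on (carrier B \<inter> carrier C) B C"
    using assms unfolding pba_def by (elim conjE)
  have 5: "\<forall>B\<in>F. \<forall>S. subalgebra S B \<longrightarrow> B\<lparr>carrier := S\<rparr> \<in> F"
    using assms unfolding pba_def by (elim conjE)
  show "F \<noteq> {}"
    using assms unfolding pba_def by (elim conjE)
  show "boolean_algebra_on B" if "B \<in> F"
    using 2 that by (rule bspec)
  show "B\<lparr>carrier := carrier B \<inter> carrier C\<rparr> \<in> F"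
    "ops_coincide_on (carrier B \<inter> carrier C) B C" if "B \<in> F" "C \<in> F"
    using bspec[OF bspec[OF 3 that(1)] that(2)] by (auto simp only:)
  show "B\<lparr>carrier := S\<rparr> \<in> F" if "B \<in> F" "subalgebra S B"
    using bspec[OF 5 that(1)] that(2) by (elim allE impE)
qed

lemma carrier_subset_universe: "B \<in> F \<Longrightarrow> carrier B \<subseteq> universe F"
  by (auto simp: universe_def)

lemma stateD:
  assumes "state F f"
  shows "a \<in> universe F \<Longrightarrow> 0 \<le> f a \<and> f a \<le> 1"
    "B \<in> F \<Longrightarrow> f (one B) = 1"
    "B \<in> F \<Longrightarrow> a \<in> carrier B \<Longrightarrow> b \<in> carrier B \<Longrightarrow> meet B a b = zero B \<Longrightarrow> f (join B a b) = f a + f b"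
  using assms unfolding state_def by blast+

lemma state_zero:
  assumes "pba F" "state F f" "B \<in> F"
  shows "f (zero B) = 0"
proof -
  interpret carrier_boolean_algebra B
    using assms pbaD(2) by unfold_locales
  have "f (join B (zero B) (zero B)) = f (zero B) + f (zero B)"
    by (rule stateD(3)[OF assms(2,3)]) simp_all
  then show ?thesis by simp
qed

lemma state_pullback:
  assumes "state F' f" "pba_hom F F' p"
  shows "state F (f \<circ> p)"
  unfolding state_def
proof (intro conjI ballI impI)
  have p: "\<exists>B'\<in>F'. ba_hom B B' p" if "B \<in> F" for B
    using assms(2) that unfolding pba_hom_def by blast
  show "0 \<le> (f \<circ> p) a" "(f \<circ> p) a \<le> 1" if a: "a \<in> universe F" for a
  proof -
    obtain B where B: "B \<in> F" "a \<in> carrier B"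
      using a unfolding universe_def by blast
    obtain B' where B': "B' \<in> F'" "ba_hom B B' p"
      using p[OF B(1)] by (rule bexE)
    have "p a \<in> universe F'"
      unfolding universe_def using B'(1) ba_homD(1)[OF B'(2) B(2)] by (rule UN_I)
    then show "0 \<le> (f \<circ> p) a" "(f \<circ> p) a \<le> 1"
      using stateD(1)[OF assms(1)] by simp_all
  qed
  fix B assume B: "B \<in> F"
  obtain B' where B': "B' \<in> F'" "ba_hom B B' p"
    using p[OF B] by (rule bexE)
  note h = ba_homD[OF B'(2)]
  show "(f \<circ> p) (one B) = 1"
    using stateD(2)[OF assms(1) B'(1)] h(3) by simp
  fix a b assume ab: "a \<in> carrier B" "b \<in> carrier B" "meet B a b = zero B"
  have "meet B' (p a) (p b) = zero B'"
    using h(2) h(5)[OF ab(1,2)] ab(3) by simp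
  then show "(f \<circ> p) (join B a b) = (f \<circ> p) a + (f \<circ> p) b"
    using stateD(3)[OF assms(1) B'(1), of "p a" "p b"] h(1) h(6)[OF ab(1,2)] ab(1,2) by simp
qed

section \<open>Transport of structure along an injective map\<close>

text \<open>\<open>\<psi>\<close> renames elements and its left inverse \<open>\<phi>\<close> reads
  the names back. It is used with \<open>\<psi> x\<close> the fibre of \<open>p\<close> over
  \<open>x\<close>: the quotient inherits its operations from \<open>Ft\<close>, so no operation on
  classes has to be checked for well-definedness.\<close>

definition push :: "('a \<Rightarrow> 'b) \<Rightarrow> ('b \<Rightarrow> 'a) \<Rightarrow> 'a balg \<Rightarrow> 'b balg" where
  "push \<psi> \<phi> B = \<lparr>carrier = \<psi> ` carrier B,
     meet = (\<lambda>u v. \<psi> (meet B (\<phi> u) (\<phi> v))), join = (\<lambda>u v. \<psi> (join B (\<phi> u) (\<phi> v))),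
     compl = (\<lambda>u. \<psi> (compl B (\<phi> u))), zero = \<psi> (zero B), one = \<psi> (one B)\<rparr>"

lemma push_simps [simp]:
  "carrier (push \<psi> \<phi> B) = \<psi> ` carrier B"
  "meet (push \<psi> \<phi> B) u v = \<psi> (meet B (\<phi> u) (\<phi> v))"
  "join (push \<psi> \<phi> B) u v = \<psi> (join B (\<phi> u) (\<phi> v))"
  "compl (push \<psi> \<phi> B) u = \<psi> (compl B (\<phi> u))"
  "zero (push \<psi> \<phi> B) = \<psi> (zero B)" "one (push \<psi> \<phi> B) = \<psi> (one B)"
  by (simp_all add: push_def)

text \<open>\<open>pba\<close> asks for the very record with a restricted carrier, so closure needs
  an equality of records; it holds since the operations of \<open>push\<close> do not mention the
  carrier.\<close>

lemma push_carrier: "(push \<psi> \<phi> B)\<lparr>carrier := \<psi> ` S\<rparr> = push \<psi> \<phi> (B\<lparr>carrier := S\<rparr>)"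
  by (simp add: push_def)

lemma boolean_algebra_on_push:
  assumes "boolean_algebra_on B" and inv: "\<And>x. x \<in> carrier B \<Longrightarrow> \<phi> (\<psi> x) = x"
  shows "boolean_algebra_on (push \<psi> \<phi> B)"
proof -
  interpret carrier_boolean_algebra B
    by unfold_locales fact
  show ?thesis
    unfolding boolean_algebra_on_def push_simps ball_simps
    by (intro conjI ballI) (simp_all add: inv, (rule arg_cong[where f = \<psi>], rule assoc distrib commute; assumption)+)
qed

lemma ba_hom_push:
  assumes "boolean_algebra_on B" and inv: "\<And>x. x \<in> carrier B \<Longrightarrow> \<phi> (\<psi> x) = x"
  shows "ba_hom (push \<psi> \<phi> B) B \<phi>" "ba_hom B (push \<psi> \<phi> B) \<psi>"
proof -
  interpret carrier_boolean_algebra B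
    by unfold_locales fact
  show "ba_hom (push \<psi> \<phi> B) B \<phi>" "ba_hom B (push \<psi> \<phi> B) \<psi>"
    unfolding ba_hom_def push_simps by (simp_all add: inv image_subset_iff)
qed

text \<open>The left inverse makes \<open>\<psi>\<close> injective on the universe, so overlaps of
  transported algebras are transported overlaps.\<close>

lemma pba_push:
  assumes F: "pba F" and inv: "\<And>x. x \<in> universe F \<Longrightarrow> \<phi> (\<psi> x) = x"
  shows "pba (push \<psi> \<phi> ` F)"
  unfolding pba_def
proof (intro conjI ballI allI impI)
  show "push \<psi> \<phi> ` F \<noteq> {}"
    using pbaD(1)[OF F] by simp
  have inv': "\<phi> (\<psi> x) = x" if "B \<in> F" "x \<in> carrier B" for x B
    using inv carrier_subset_universe[OF that(1)] that(2) by blast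
  have Int: "\<psi> ` S \<inter> \<psi> ` T = \<psi> ` (S \<inter> T)" if "S \<subseteq> universe F" "T \<subseteq> universe F" for S T
    using that inv by (metis inj_on_image_Int inj_on_inverseI)
  fix D assume "D \<in> push \<psi> \<phi> ` F"
  then obtain B where B: "B \<in> F" and D: "D = push \<psi> \<phi> B"
    by (rule imageE)
  show "boolean_algebra_on D"
    unfolding D by (rule boolean_algebra_on_push[where \<phi> = \<phi> and \<psi> = \<psi>, OF pbaD(2)[OF F B] inv'[OF B]])
  {
    fix E assume "E \<in> push \<psi> \<phi> ` F"
    then obtain C where C: "C \<in> F" and E: "E = push \<psi> \<phi> C"
      by (rule imageE)
    have carr: "carrier D \<inter> carrier E = \<psi> ` (carrier B \<inter> carrier C)"
      using Int carrier_subset_universe[OF B] carrier_subset_universe[OF C] by (simp add: D E)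
    show "D\<lparr>carrier := carrier D \<inter> carrier E\<rparr> \<in> push \<psi> \<phi> ` F"
      unfolding carr unfolding D push_carrier by (rule imageI[OF pbaD(3)[OF F B C]])
    show "ops_coincide_on (carrier D \<inter> carrier E) D E"
      unfolding carr unfolding D E using pbaD(4)[OF F B C]
      by (simp add: ops_coincide_on_def inv'[OF B])
  }
  fix S assume S: "subalgebra S D"
  \<comment> \<open>For (P2) the subalgebra is carried back to \<open>B\<close> by
    \<open>\<phi>\<close>, found in \<open>F\<close> there, and pushed forward again.\<close>
  have "subalgebra (\<phi> ` S) B"
    using ba_hom_push(1)[where \<phi> = \<phi> and \<psi> = \<psi>, OF pbaD(2)[OF F B] inv'[OF B]] S unfolding D by (rule subalgebra_image)
  then have "push \<psi> \<phi> (B\<lparr>carrier := \<phi> ` S\<rparr>) \<in> push \<psi> \<phi> ` F"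
    by (intro imageI pbaD(5)[OF F B])
  moreover have "\<psi> ` \<phi> ` S = S"
  proof -
    have "\<psi> (\<phi> u) = u" if "u \<in> S" for u
      using that S inv'[OF B] by (auto simp: D subalgebra_def)
    then show ?thesis by (simp add: image_image)
  qed
  ultimately show "D\<lparr>carrier := S\<rparr> \<in> push \<psi> \<phi> ` F"
    unfolding D by (simp flip: push_carrier)
qed

lemma universe_push: "universe (push \<psi> \<phi> ` F) = \<psi> ` universe F"
  by (auto simp: universe_def)

lemma ba_hom_cong:
  assumes "boolean_algebra_on A" "ba_hom A B h" "\<And>a. a \<in> carrier A \<Longrightarrow> g a = h a"
  shows "ba_hom A B g"
proof -
  interpret carrier_boolean_algebra A
    by unfold_locales fact
  show ?thesis
    using assms(2) unfolding ba_hom_def by (simp add: assms(3) image_subset_iff)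
qed

lemma pba_iso_push:
  assumes F: "pba F" and inv: "\<And>x. x \<in> universe F \<Longrightarrow> \<phi> (\<psi> x) = x"
  shows "pba_iso (push \<psi> \<phi> ` F) F \<phi>"
proof -
  let ?U = "universe (push \<psi> \<phi> ` F)"
  have inv': "\<phi> (\<psi> x) = x" if "B \<in> F" "x \<in> carrier B" for x B
    using inv carrier_subset_universe[OF that(1)] that(2) by blast
  have bij: "bij_betw \<phi> ?U (universe F)"
    unfolding universe_push by (rule bij_betw_byWitness[of _ \<psi>]) (auto simp: inv)
  \<comment> \<open>\<open>pba_iso\<close> speaks of \<open>inv_into\<close>, which is identified
    with \<open>\<psi>\<close> on the universe; \<open>ba_hom_cong\<close> then transfers the
    homomorphism property.\<close>
  have inv_into: "inv_into ?U \<phi> x = \<psi> x" if "x \<in> universe F" for x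
    using that bij by (intro inv_into_f_eq) (auto simp: bij_betw_def universe_push inv)
  have "pba_hom (push \<psi> \<phi> ` F) F \<phi>"
    unfolding pba_hom_def
  proof
    fix D assume "D \<in> push \<psi> \<phi> ` F"
    then obtain B where B: "B \<in> F" and D: "D = push \<psi> \<phi> B"
      by (rule imageE)
    have "ba_hom D B \<phi>"
      unfolding D by (rule ba_hom_push(1)[where \<phi> = \<phi> and \<psi> = \<psi>, OF pbaD(2)[OF F B] inv'[OF B]])
    moreover have "carrier B = \<phi> ` carrier D"
      using inv'[OF B] by (simp add: D image_image)
    ultimately show "\<exists>B'\<in>F. carrier B' = \<phi> ` carrier D \<and> ba_hom D B' \<phi>"
      using B by (intro bexI[of _ B] conjI)
  qed
  moreover have "pba_hom F (push \<psi> \<phi> ` F) (inv_into ?U \<phi>)"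
    unfolding pba_hom_def
  proof
    fix B assume B: "B \<in> F"
    have eq: "inv_into ?U \<phi> x = \<psi> x" if "x \<in> carrier B" for x
      using inv_into carrier_subset_universe[OF B] that by blast
    have "ba_hom B (push \<psi> \<phi> B) (inv_into ?U \<phi>)"
      using pbaD(2)[OF F B] ba_hom_push(2)[where \<phi> = \<phi> and \<psi> = \<psi>, OF pbaD(2)[OF F B] inv'[OF B]] eq by (rule ba_hom_cong)
    moreover have "carrier (push \<psi> \<phi> B) = inv_into ?U \<phi> ` carrier B"
      by (simp add: eq cong: image_cong)
    ultimately show "\<exists>B'\<in>push \<psi> \<phi> ` F. carrier B' = inv_into ?U \<phi> ` carrier B \<and> ba_hom B B' (inv_into ?U \<phi>)"
      using B by (intro bexI[of _ "push \<psi> \<phi> B"] conjI imageI)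
  qed
  ultimately show ?thesis
    using bij unfolding pba_iso_def by blast
qed

section \<open>From a homomorphism onto \<open>Ft\<close> to an empirical quotient\<close>

lemma ba_hom_comp:
  assumes g: "ba_hom A B g" and h: "ba_hom B C h"
  shows "ba_hom A C (\<lambda>a. h (g a))"
  unfolding ba_hom_def
  using ba_homD[OF g] ba_homD[OF h] by (simp add: image_subset_iff)

lemma ba_hom_sym_diff:
  assumes "boolean_algebra_on A" and h: "ba_hom A B h" and "a \<in> carrier A" "b \<in> carrier A"
  shows "h (ba_sym_diff A a b) = ba_sym_diff B (h a) (h b)"
proof -
  interpret carrier_boolean_algebra A
    by unfold_locales fact
  show ?thesis
    using assms(3,4) by (simp add: ba_sym_diff_def ba_homD[OF h])
qed

lemma pba_homE:
  assumes "pba_hom F F' p" "B \<in> F"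
  obtains N where "N \<in> F'" "carrier N = p ` carrier B" "ba_hom B N p"
  using bspec[OF assms(1)[unfolded pba_hom_def] assms(2)] by (elim bexE conjE)

text \<open>The induced ideals are the kernels of \<open>p\<close>: completeness separates the elements of \<open>Ft\<close>
  from zero, so \<open>p\<close> identifies exactly what the states cannot distinguish.\<close>

lemma empirical_quotientI:
  assumes F: "pba F" and Ft: "pba Ft" and p: "pba_hom F Ft p"
    and onto: "\<And>N. N \<in> Ft \<Longrightarrow> \<exists>B\<in>F. carrier N = p ` carrier B"
    and compl: "complete_states Ft K ft" and st: "\<And>k. k \<in> K \<Longrightarrow> state Ft (ft k)"
    and lift: "\<And>B C a b. maximal_in F B \<Longrightarrow> maximal_in F C \<Longrightarrow> a \<in> carrier B \<Longrightarrow> b \<in> carrier C \<Longrightarrow>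
      p a = p b \<Longrightarrow> \<exists>c\<in>carrier B \<inter> carrier C. p c = p a"
  shows "empirical_quotient K Ft ft F (\<lambda>k. ft k \<circ> p)"
proof -
  define U where "U = universe F"
  define r where "r = {(a, b). a \<in> U \<and> b \<in> U \<and> p a = p b}"
  \<comment> \<open>Elements of \<open>Ft\<close> are named by their fibres; \<open>\<phi>\<close>
    recovers the element by evaluating \<open>p\<close> at any representative.\<close>
  define \<psi> where "\<psi> x = {a \<in> U. p a = x}" for x
  define \<phi> where "\<phi> c = p (SOME a. a \<in> c)" for c
  define Q where "Q = push \<psi> \<phi> ` Ft"
  have U: "a \<in> U" if "a \<in> carrier B" "B \<in> F" for a B
    using carrier_subset_universe[OF that(2)] that(1) unfolding U_def by (rule subsetD)
  have image: "p ` U = universe Ft"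
  proof
    show "p ` U \<subseteq> universe Ft"
    proof (rule image_subsetI)
      fix a assume "a \<in> U"
      then obtain B where B: "B \<in> F" "a \<in> carrier B"
        unfolding U_def universe_def by (rule UN_E)
      obtain N where "N \<in> Ft" "carrier N = p ` carrier B"
        by (rule pba_homE[OF p B(1)])
      then show "p a \<in> universe Ft"
        using B(2) carrier_subset_universe[of N Ft] by auto
    qed
    show "universe Ft \<subseteq> p ` U"
    proof
      fix x assume "x \<in> universe Ft"
      then obtain N where N: "N \<in> Ft" "x \<in> carrier N"
        unfolding universe_def by (rule UN_E)
      obtain B where "B \<in> F" "carrier N = p ` carrier B"
        using onto[OF N(1)] by (rule bexE)
      then show "x \<in> p ` U"
        using N(2) U by auto
    qed
  qed
  have inv: "\<phi> (\<psi> x) = x" if "x \<in> universe Ft" for x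
  proof -
    have "\<exists>a. a \<in> \<psi> x"
      using that unfolding image[symmetric] \<psi>_def by auto
    then have "(SOME a. a \<in> \<psi> x) \<in> \<psi> x"
      by (rule someI_ex)
    then show ?thesis
      by (simp add: \<phi>_def \<psi>_def)
  qed
  have inv': "\<phi> (\<psi> x) = x" if "N \<in> Ft" "x \<in> carrier N" for x N
    using subsetD[OF carrier_subset_universe[OF that(1)] that(2)] by (rule inv)
  \<comment> \<open>Classes are fibres, so the projection to the quotient is \<open>p\<close>
    followed by \<open>\<psi>\<close>, a composite of homomorphisms.\<close>
  have cls: "r `` {a} = \<psi> (p a)" if "a \<in> U" for a
    using that by (auto simp: r_def \<psi>_def)
  have "equiv U r"
    by (auto simp: r_def equiv_def refl_on_def sym_def trans_def)
  moreover have "(a, b) \<in> r \<longleftrightarrow> ba_sym_diff B a b \<in> null_ideal K (\<lambda>k. ft k \<circ> p) B"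
    if B: "B \<in> F" and a: "a \<in> carrier B" and b: "b \<in> carrier B" for B a b
  proof -
    interpret B: carrier_boolean_algebra B
      by unfold_locales (rule pbaD(2)[OF F B])
    obtain N where N: "N \<in> Ft" "ba_hom B N p"
      by (rule pba_homE[OF p B])
    interpret N: carrier_boolean_algebra N
      by unfold_locales (rule pbaD(2)[OF Ft N(1)])
    have pa: "p a \<in> carrier N" "p b \<in> carrier N"
      using a b ba_homD(1)[OF N(2)] by auto
    have cl: "ba_sym_diff B a b \<in> carrier B" "ba_sym_diff N (p a) (p b) \<in> carrier N"
      using a b pa by (simp_all add: ba_sym_diff_def)
    \<comment> \<open>One direction is that states vanish at zero, the other is
      completeness.\<close>
    have null: "x = zero N \<longleftrightarrow> (\<forall>k\<in>K. ft k x = 0)" if "x \<in> carrier N" for x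
    proof
      assume "x = zero N"
      then show "\<forall>k\<in>K. ft k x = 0"
        using state_zero[OF Ft st N(1)] by simp
    next
      assume "\<forall>k\<in>K. ft k x = 0"
      then show "x = zero N"
        using bspec[OF bspec[OF compl[unfolded complete_states_def] N(1)] that] by blast
    qed
    have "(a, b) \<in> r \<longleftrightarrow> p a = p b"
      using U[OF a B] U[OF b B] by (simp add: r_def)
    also have "\<dots> \<longleftrightarrow> (\<forall>k\<in>K. ft k (ba_sym_diff N (p a) (p b)) = 0)"
      using N.sym_diff_eq_zero_iff[OF pa] null[OF cl(2)] by simp
    also have "\<dots> \<longleftrightarrow> ba_sym_diff B a b \<in> null_ideal K (\<lambda>k. ft k \<circ> p) B"
      using cl(1) ba_hom_sym_diff[OF B.ba N(2) a b] by (simp add: null_ideal_def)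
    finally show ?thesis .
  qed
  moreover have "\<exists>c\<in>carrier B \<inter> carrier C. (a, c) \<in> r"
    if B: "maximal_in F B" and C: "maximal_in F C" and a: "a \<in> carrier B" and b: "b \<in> carrier C"
      and ab: "(a, b) \<in> r" for B C a b
  proof -
    have "p a = p b"
      using ab by (simp add: r_def)
    from lift[OF B C a b this] obtain c where c: "c \<in> carrier B \<inter> carrier C" "p c = p a"
      by (rule bexE)
    have "B \<in> F"
      using B by (simp add: maximal_in_def)
    then have "(a, c) \<in> r"
      using U[of a B] U[of c B] a c by (simp add: r_def)
    then show ?thesis
      using c(1) by (rule bexI)
  qed
  moreover have "quotient_pba F r Q"
    unfolding quotient_pba_def
  proof (intro conjI ballI)
    show "pba Q"
      unfolding Q_def by (rule pba_push[where \<phi> = \<phi> and \<psi> = \<psi>, OF Ft inv])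
    have "universe F // r = (\<lambda>a. r `` {a}) ` U"
      unfolding quotient_def U_def by blast
    also have "\<dots> = \<psi> ` p ` U"
      unfolding image_image by (rule image_cong[OF refl cls])
    finally show "universe Q = universe F // r"
      unfolding Q_def universe_push image by (rule sym)
    show "pba_hom F Q (\<lambda>a. r `` {a})"
      unfolding pba_hom_def
    proof
      fix B assume B: "B \<in> F"
      obtain N where N: "N \<in> Ft" "carrier N = p ` carrier B" "ba_hom B N p"
        by (rule pba_homE[OF p B])
      have eq: "r `` {a} = \<psi> (p a)" if "a \<in> carrier B" for a
        by (rule cls[OF U[OF that B]])
      have "ba_hom B (push \<psi> \<phi> N) (\<lambda>a. r `` {a})"
        using pbaD(2)[OF F B] ba_hom_comp[OF N(3) ba_hom_push(2)[where \<phi> = \<phi> and \<psi> = \<psi>, OF pbaD(2)[OF Ft N(1)] inv'[OF N(1)]]] eq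
        by (rule ba_hom_cong)
      moreover have "carrier (push \<psi> \<phi> N) = (\<lambda>a. r `` {a}) ` carrier B"
        by (simp add: N(2) image_image eq cong: image_cong)
      moreover have "push \<psi> \<phi> N \<in> Q"
        unfolding Q_def using N(1) by (rule imageI)
      ultimately show "\<exists>B'\<in>Q. carrier B' = (\<lambda>a. r `` {a}) ` carrier B \<and> ba_hom B B' (\<lambda>a. r `` {a})"
        by (intro bexI[of _ "push \<psi> \<phi> N"] conjI)
    qed
    fix D assume "D \<in> Q"
    then obtain N where N: "N \<in> Ft" "D = push \<psi> \<phi> N"
      unfolding Q_def by (rule imageE)
    obtain B where B: "B \<in> F" "carrier N = p ` carrier B"
      using onto[OF N(1)] by (rule bexE)
    have eq: "r `` {a} = \<psi> (p a)" if "a \<in> carrier B" for a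
      by (rule cls[OF U[OF that B(1)]])
    have "carrier D = (\<lambda>a. r `` {a}) ` carrier B"
      by (simp add: N(2) B(2) image_image eq cong: image_cong)
    then show "\<exists>B\<in>F. carrier D = (\<lambda>a. r `` {a}) ` carrier B"
      using B(1) by (rule bexI)
  qed
  moreover have "pba_iso Q Ft \<phi>"
    unfolding Q_def by (rule pba_iso_push[where \<phi> = \<phi> and \<psi> = \<psi>, OF Ft inv])
  moreover have "(ft k \<circ> p) a = ft k (\<phi> (r `` {a}))" if "a \<in> U" for k a
    using that image by (simp add: cls inv flip: image)
  ultimately show ?thesis
    unfolding empirical_quotient_def U_def by (intro exI[of _ r] exI[of _ Q] exI[of _ \<phi>] conjI allI ballI impI) simp_all
qed

section \<open>The cylinder cover of a partial Boolean algebra\<close>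

text \<open>Subalgebras of cylinders are included because (P2) demands them; the cylinders alone
  would not form a partial Boolean algebra in general.\<close>

definition cyl_cover :: "'a set \<Rightarrow> 'a balg set \<Rightarrow> 'a set set balg set" where
  "cyl_cover X Ft =
     {set_alg X\<lparr>carrier := T\<rparr> | T. subalgebra T (set_alg X) \<and> (\<exists>M\<in>Ft. T \<subseteq> cyl X (carrier M))}"

lemma cyl_coverE:
  assumes "B \<in> cyl_cover X Ft"
  obtains T M where "B = set_alg X\<lparr>carrier := T\<rparr>" "subalgebra T (set_alg X)" "M \<in> Ft"
    "T \<subseteq> cyl X (carrier M)"
  using assms unfolding cyl_cover_def by blast

lemma cyl_coverI:
  assumes "subalgebra T (set_alg X)" "M \<in> Ft" "T \<subseteq> cyl X (carrier M)"
  shows "set_alg X\<lparr>carrier := T\<rparr> \<in> cyl_cover X Ft"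
  using assms unfolding cyl_cover_def by blast

lemma cyl_in_cover: "M \<in> Ft \<Longrightarrow> set_alg X\<lparr>carrier := cyl X (carrier M)\<rparr> \<in> cyl_cover X Ft"
  by (rule cyl_coverI[OF subalgebra_cyl _ order_refl])

lemma subalgebra_Int: "subalgebra S B \<Longrightarrow> subalgebra T B \<Longrightarrow> subalgebra (S \<inter> T) B"
  unfolding subalgebra_def by (simp add: le_infI1)

lemma subalgebra_trans:
  "subalgebra S (B\<lparr>carrier := T\<rparr>) \<Longrightarrow> subalgebra T B \<Longrightarrow> subalgebra S B"
  unfolding subalgebra_def by (simp add: subset_trans[of S T])

text \<open>All members carry the operations of \<open>set_alg X\<close>, so agreement on overlaps
  is automatic, and an intersection stays inside the cylinder that bounds its first factor.\<close>

lemma pba_cyl_cover: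
  assumes "Ft \<noteq> {}"
  shows "pba (cyl_cover X Ft)"
  unfolding pba_def
proof (intro conjI ballI allI impI)
  interpret carrier_boolean_algebra "set_alg X"
    by unfold_locales (rule boolean_algebra_on_set_alg)
  show "cyl_cover X Ft \<noteq> {}"
    using assms cyl_in_cover by (metis all_not_in_conv)
  fix B assume "B \<in> cyl_cover X Ft"
  then obtain T M where B: "B = set_alg X\<lparr>carrier := T\<rparr>" and T: "subalgebra T (set_alg X)"
    and M: "M \<in> Ft" "T \<subseteq> cyl X (carrier M)"
    by (rule cyl_coverE)
  show "boolean_algebra_on B"
    unfolding B by (rule boolean_algebra_on_subalgebra[OF T])
  {
    fix C assume "C \<in> cyl_cover X Ft"
    then obtain T' where C: "C = set_alg X\<lparr>carrier := T'\<rparr>" and T': "subalgebra T' (set_alg X)"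
      by (rule cyl_coverE)
    have "set_alg X\<lparr>carrier := T \<inter> T'\<rparr> \<in> cyl_cover X Ft"
      using subalgebra_Int[OF T T'] M by (rule cyl_coverI[OF _ _ le_infI1])
    then show "B\<lparr>carrier := carrier B \<inter> carrier C\<rparr> \<in> cyl_cover X Ft"
      by (simp add: B C)
    show "ops_coincide_on (carrier B \<inter> carrier C) B C"
      by (simp add: B C ops_coincide_on_def)
  }
  fix S assume S: "subalgebra S B"
  then have "S \<subseteq> T"
    by (simp add: B subalgebra_def)
  then have "set_alg X\<lparr>carrier := S\<rparr> \<in> cyl_cover X Ft"
    using cyl_coverI[OF subalgebra_trans[OF S[unfolded B] T] M(1)] M(2) by simp
  then show "B\<lparr>carrier := S\<rparr> \<in> cyl_cover X Ft"
    by (simp add: B)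
qed

lemma universe_cyl_cover_subset: "universe (cyl_cover X Ft) \<subseteq> Pow (Pow X)"
  unfolding universe_def
proof (rule UN_least)
  fix B assume "B \<in> cyl_cover X Ft"
  then show "carrier B \<subseteq> Pow (Pow X)"
    by (rule cyl_coverE) (simp add: subalgebra_def)
qed

lemma embedding_cyl_cover: "embedding (cyl_cover X Ft) (set_alg X) id"
proof -
  have "pba_hom (cyl_cover X Ft) (pba_of_ba (set_alg X)) id"
    unfolding pba_hom_def
  proof
    fix B assume "B \<in> cyl_cover X Ft"
    then have "B \<in> pba_of_ba (set_alg X)"
      unfolding pba_of_ba_def by (rule cyl_coverE) blast
    moreover have "ba_hom B B id"
      by (simp add: ba_hom_def)
    ultimately show "\<exists>B'\<in>pba_of_ba (set_alg X). carrier B' = id ` carrier B \<and> ba_hom B B' id"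
      by (intro bexI[of _ B] conjI) simp_all
  qed
  then show ?thesis
    by (simp add: embedding_def boolean_algebra_on_set_alg)
qed

text \<open>The bounding cylinder is itself a member, so a maximal member must fill it. Hence it
  contains the generators of all elements of \<open>M\<close>, which a proper subalgebra may miss;
  this is where maximality enters condition (ii).\<close>

lemma maximal_in_cyl_cover:
  assumes "maximal_in (cyl_cover X Ft) B"
  obtains M where "M \<in> Ft" "carrier B = cyl X (carrier M)"
proof -
  have "B \<in> cyl_cover X Ft"
    using assms by (simp add: maximal_in_def)
  then obtain T M where B: "B = set_alg X\<lparr>carrier := T\<rparr>" and M: "M \<in> Ft" "T \<subseteq> cyl X (carrier M)"
    by (rule cyl_coverE)
  have "\<not> T \<subset> cyl X (carrier M)"
    using assms cyl_in_cover[OF M(1), of X] unfolding maximal_in_def B by fastforce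
  then have "carrier B = cyl X (carrier M)"
    using M(2) by (simp add: B psubset_eq)
  with M(1) show thesis
    by (rule that)
qed

text \<open>The canonical maps \<open>cyl X (carrier M) \<rightarrow> M\<close> glue because \<open>cyl\<close> turns intersections into
  intersections: on an overlap both maps are determined by the generators in \<open>carrier M \<inter> carrier N\<close>.\<close>

lemma cyl_projection:
  assumes Ft: "pba Ft" and fin: "finite (universe Ft)" and X: "X = universe Ft"
  shows "\<exists>p. (\<forall>M\<in>Ft. ba_hom (set_alg X\<lparr>carrier := cyl X (carrier M)\<rparr>) M p) \<and>
    (\<forall>x\<in>X. p (gen X x) = x)"
proof -
  interpret S: carrier_boolean_algebra "set_alg X"
    by unfold_locales (rule boolean_algebra_on_set_alg)
  have MX: "carrier M \<subseteq> X" if "M \<in> Ft" for M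
    unfolding X using that by (rule carrier_subset_universe)
  have finM: "finite (carrier M)" if "M \<in> Ft" for M
    using MX[OF that] fin unfolding X by (rule finite_subset)
  have "\<forall>M\<in>Ft. \<exists>H. ba_hom (set_alg X\<lparr>carrier := cyl X (carrier M)\<rparr>) M H \<and>
      (\<forall>x\<in>carrier M. H (gen X x) = x)"
  proof
    fix M assume M: "M \<in> Ft"
    show "\<exists>H. ba_hom (set_alg X\<lparr>carrier := cyl X (carrier M)\<rparr>) M H \<and>
        (\<forall>x\<in>carrier M. H (gen X x) = x)"
      by (rule cyl_extension[OF pbaD(2)[OF Ft M] finM[OF M] MX[OF M]]) simp
  qed
  then obtain P where P: "\<forall>M\<in>Ft. ba_hom (set_alg X\<lparr>carrier := cyl X (carrier M)\<rparr>) M (P M) \<and>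
      (\<forall>x\<in>carrier M. P M (gen X x) = x)"
    by (rule bchoice[THEN exE])
  have hom: "ba_hom (set_alg X\<lparr>carrier := cyl X (carrier M)\<rparr>) M (P M)" if "M \<in> Ft" for M
    using bspec[OF P that] by (rule conjunct1)
  have gen: "P M (gen X x) = x" if "M \<in> Ft" "x \<in> carrier M" for M x
    using bspec[OF conjunct2[OF bspec[OF P that(1)]] that(2)] .
  have agree: "P M A = P N A"
    if M: "M \<in> Ft" and N: "N \<in> Ft" and A: "A \<in> cyl X (carrier M)" "A \<in> cyl X (carrier N)" for M N A
  proof -
    let ?S = "carrier M \<inter> carrier N"
    \<comment> \<open>The equalizer of the two local maps on the common cylinder.\<close>
    let ?T = "{A \<in> cyl X ?S. P M A = P N A}"
    have sub: "A \<in> cyl X (carrier M)" "A \<in> cyl X (carrier N)" if "A \<in> cyl X ?S" for A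
      using that cyl_Int[of X "carrier M" "carrier N"] by auto
    note hM = ba_homD[OF hom[OF M], simplified] and hN = ba_homD[OF hom[OF N], simplified]
    have ops: "zero M = zero N" "one M = one N"
      "\<And>a. a \<in> ?S \<Longrightarrow> compl M a = compl N a"
      "\<And>a b. a \<in> ?S \<Longrightarrow> b \<in> ?S \<Longrightarrow> meet M a b = meet N a b"
      "\<And>a b. a \<in> ?S \<Longrightarrow> b \<in> ?S \<Longrightarrow> join M a b = join N a b"
      using pbaD(4)[OF Ft M N] unfolding ops_coincide_on_def by blast+
    \<comment> \<open>The common value lies in both carriers, exactly where the operations of
      \<open>M\<close> and \<open>N\<close> are known to coincide; this closes \<open>?T\<close>
      under the operations.\<close>
    have val: "P N A \<in> ?S" if "A \<in> ?T" for A
      using that hM(1)[of A] hN(1)[of A] sub[of A] by auto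
    note cyl = subalgebra_cyl[of X ?S, unfolded subalgebra_def set_alg_simps]
    have "subalgebra ?T (set_alg X)"
      unfolding subalgebra_def set_alg_simps
    proof (intro conjI ballI)
      show "?T \<subseteq> Pow (Pow X)" using cyl by blast
      show "{} \<in> ?T" "Pow X \<in> ?T"
        using cyl hM(2,3) hN(2,3) ops(1,2) by simp_all
      fix A assume A: "A \<in> ?T"
      then have A': "A \<in> cyl X ?S" "P M A = P N A" by simp_all
      show "Pow X - A \<in> ?T"
        using cyl A' hM(4)[OF sub(1)[OF A'(1)]] hN(4)[OF sub(2)[OF A'(1)]] ops(3)[OF val[OF A]] by simp
      fix B assume B: "B \<in> ?T"
      then have B': "B \<in> cyl X ?S" "P M B = P N B" by simp_all
      show "A \<inter> B \<in> ?T"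
        using cyl A' B' hM(5)[OF sub(1)[OF A'(1)] sub(1)[OF B'(1)]]
          hN(5)[OF sub(2)[OF A'(1)] sub(2)[OF B'(1)]] ops(4)[OF val[OF A] val[OF B]] by simp
      show "A \<union> B \<in> ?T"
        using cyl A' B' hM(6)[OF sub(1)[OF A'(1)] sub(1)[OF B'(1)]]
          hN(6)[OF sub(2)[OF A'(1)] sub(2)[OF B'(1)]] ops(5)[OF val[OF A] val[OF B]] by simp
    qed
    moreover have "gen X ` ?S \<subseteq> ?T"
      using gen_in_cyl[of _ ?S X] gen[OF M] gen[OF N] by auto
    moreover have "finite ?S" "?S \<subseteq> X"
      using finM[OF M] MX[OF M] by auto
    ultimately have "cyl X ?S \<subseteq> ?T"
      by (intro cyl_generated)
    moreover have "A \<in> cyl X ?S"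
      using A cyl_Int[of X "carrier M" "carrier N"] by auto
    ultimately have "A \<in> ?T" by (rule subsetD)
    then show ?thesis by simp
  qed
  \<comment> \<open>By \<open>agree\<close> the chosen member does not matter; outside all cylinders
    the value is arbitrary.\<close>
  define p where "p A = P (SOME M. M \<in> Ft \<and> A \<in> cyl X (carrier M)) A" for A
  have p: "p A = P M A" if "M \<in> Ft" "A \<in> cyl X (carrier M)" for M A
  proof -
    let ?N = "SOME M. M \<in> Ft \<and> A \<in> cyl X (carrier M)"
    have N: "?N \<in> Ft \<and> A \<in> cyl X (carrier ?N)"
      by (rule someI[of _ M]) (use that in simp)
    show ?thesis
      unfolding p_def by (rule agree[OF conjunct1[OF N] that(1) conjunct2[OF N] that(2)])
  qed
  have "ba_hom (set_alg X\<lparr>carrier := cyl X (carrier M)\<rparr>) M p" if M: "M \<in> Ft" for M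
    by (rule ba_hom_cong[OF S.boolean_algebra_on_subalgebra[OF subalgebra_cyl] hom[OF M]])
      (simp add: p[OF M])
  moreover have "p (gen X x) = x" if x: "x \<in> X" for x
  proof -
    obtain M where M: "M \<in> Ft" "x \<in> carrier M"
      using x unfolding X universe_def by (rule UN_E)
    then show ?thesis
      using p[OF M(1) gen_in_cyl[OF M(2)]] gen by simp
  qed
  ultimately show ?thesis
    by (intro exI[of _ p] conjI ballI)
qed

text \<open>The image of a subalgebra of a cylinder is a subalgebra of \<open>M\<close>, so (P2) in
  \<open>Ft\<close> places it in the target family.\<close>

lemma pba_hom_cyl_cover:
  assumes Ft: "pba Ft"
    and p: "\<And>M. M \<in> Ft \<Longrightarrow> ba_hom (set_alg X\<lparr>carrier := cyl X (carrier M)\<rparr>) M p"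
  shows "pba_hom (cyl_cover X Ft) Ft p"
  unfolding pba_hom_def
proof
  fix B assume "B \<in> cyl_cover X Ft"
  then obtain T M where B: "B = set_alg X\<lparr>carrier := T\<rparr>" and T: "subalgebra T (set_alg X)"
    and M: "M \<in> Ft" "T \<subseteq> cyl X (carrier M)"
    by (rule cyl_coverE)
  have "subalgebra T (set_alg X\<lparr>carrier := cyl X (carrier M)\<rparr>)"
    using T M(2) by (simp add: subalgebra_def)
  then have "M\<lparr>carrier := p ` T\<rparr> \<in> Ft"
    by (intro pbaD(5)[OF Ft M(1)] subalgebra_image[OF p[OF M(1)]])
  moreover have "ba_hom B (M\<lparr>carrier := p ` T\<rparr>) p"
    using ba_homD[OF p[OF M(1)], simplified] M(2)
    unfolding ba_hom_def B by (simp add: subset_iff)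
  ultimately show "\<exists>B'\<in>Ft. carrier B' = p ` carrier B \<and> ba_hom B B' p"
    by (intro bexI[of _ "M\<lparr>carrier := p ` T\<rparr>"] conjI) (simp_all add: B)
qed

theorem mainTheorem2:
  fixes Ft :: "'a balg set"
    and K :: "'k set"
    and ft :: "'k \<Rightarrow> 'a \<Rightarrow> real"
  assumes "pba Ft"
    and "finite (universe Ft)"
    and "\<forall>k\<in>K. ppt (Ft, ft k)"
    and "complete_states Ft K ft"
  shows "\<exists>(F :: 'a set set balg set) (f :: 'k \<Rightarrow> 'a set set \<Rightarrow> real).
           pba F \<and> finite (universe F) \<and> (\<forall>k\<in>K. ppt (F, f k)) \<and>
           (\<exists>(B :: 'a set set balg) \<phi>. free_ba B \<and> embedding F B \<phi>) \<and>
           empirical_quotient K Ft ft F f"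
proof -
  define X where "X = universe Ft"
  obtain p where hom_cyl: "\<forall>M\<in>Ft. ba_hom (set_alg X\<lparr>carrier := cyl X (carrier M)\<rparr>) M p"
    and gen: "\<forall>x\<in>X. p (gen X x) = x"
    using cyl_projection[OF assms(1,2) X_def] by (elim exE conjE)
  note p = bspec[OF hom_cyl]
  let ?F = "cyl_cover X Ft" and ?f = "\<lambda>k. ft k \<circ> p"
  have F: "pba ?F"
    by (rule pba_cyl_cover[OF pbaD(1)[OF assms(1)]])
  have hom: "pba_hom ?F Ft p"
    by (rule pba_hom_cyl_cover[OF assms(1) p])
  have st: "state Ft (ft k)" if "k \<in> K" for k
    using bspec[OF assms(3) that] by (simp add: ppt_def)
  have MX: "x \<in> X" if "M \<in> Ft" "x \<in> carrier M" for M x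
    using subsetD[OF carrier_subset_universe[OF that(1)] that(2)] by (simp add: X_def)
  have "finite (universe ?F)"
    by (rule finite_subset[OF universe_cyl_cover_subset]) (simp add: X_def assms(2))
  moreover have "\<forall>k\<in>K. ppt (?F, ?f k)"
    using F state_pullback[OF st hom] by (simp add: ppt_def)
  moreover have "\<exists>(B :: 'a set set balg) \<phi>. free_ba B \<and> embedding ?F B \<phi>"
    using free_ba_set_alg[OF assms(2)] embedding_cyl_cover[of X Ft] unfolding X_def by blast
  moreover have "empirical_quotient K Ft ft ?F ?f"
  proof (rule empirical_quotientI[OF F assms(1) hom _ assms(4) st])
    fix N assume N: "N \<in> Ft"
    \<comment> \<open>The generators alone already reach every element of \<open>N\<close>.\<close>
    have "x \<in> p ` cyl X (carrier N)" if "x \<in> carrier N" for x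
      using gen_in_cyl[OF that, of X] bspec[OF gen MX[OF N that]] by (metis imageI)
    then have "carrier N = p ` cyl X (carrier N)"
      using ba_homD(1)[OF p[OF N]] by auto
    then show "\<exists>B\<in>?F. carrier N = p ` carrier B"
      by (intro bexI[OF _ cyl_in_cover[OF N]]) simp
  next
    fix B C a b
    assume "maximal_in ?F B" "maximal_in ?F C" and ab: "a \<in> carrier B" "b \<in> carrier C" "p a = p b"
    then obtain M N where M: "M \<in> Ft" "carrier B = cyl X (carrier M)"
      and N: "N \<in> Ft" "carrier C = cyl X (carrier N)"
      by (metis maximal_in_cyl_cover)
    have "p a \<in> carrier M" "p a \<in> carrier N"
      using ba_homD(1)[OF p[OF M(1)], of a] ba_homD(1)[OF p[OF N(1)], of b] ab M(2) N(2) by simp_all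
    then show "\<exists>c\<in>carrier B \<inter> carrier C. p c = p a"
      using gen MX[OF M(1)] gen_in_cyl M(2) N(2) by (intro bexI[of _ "gen X (p a)"]) auto
  qed
  ultimately show ?thesis
    using F by (intro exI[of _ ?F] exI[of _ ?f] conjI)
qed

end
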